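(* Let $\ell,N<\infty$ be positive integers and let $\ell_{GP}\in\mathbb{N}\cup\{\infty\}$ with $\ell\le\ell_{GP}$. Let $K(x,x')=\sum_{i=1}^{\ell_{GP}}\lambda_i\phi_i(x)\phi_i(x')$ be a Mercer kernel on $(\mathcal{X},\mu)$, and let $\{(x_k,w_k):k=1,\dots,N\}$ be a quadrature rule that orthogonalizes the first $\ell$ eigenfunctions $\phi_1,\dots,\phi_\ell$. Let $\mathbf{W}=\mathrm{diag}(w_1,\dots,w_N)$, let $\sigma^2\ge0$ be such that the $N\times N$ matrix with entries $K(x_i,x_j)+\delta_{ij}\sigma^2$ is invertible, and let $\mathbf{R}$ be its inverse. Then the contribution of the first $\ell$ eigenfunctions to the integrated posterior variance of Gaussian process regression with kernel $K$, nugget $\sigma^2$ and design points $x_1,\dots,x_N$ satisfies $$\sum_{i=1}^{\ell}\lambda_i\left(1-\lambda_i\bm{\phi}_i^T\mathbf{R}\bm{\phi}_i\right)=\sum_{i=1}^{\ell}\lambda_i\bm{\phi}_i^T\mathbf{W}\left(\sum_{j=\ell+1}^{\ell_{GP}}\lambda_j\bm{\phi}_j\bm{\phi}_j^T+\sigma^2\mathbf{I}\right)\mathbf{R}\,\bm{\phi}_i .$$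
   Context: Mercer kernel: $\mathcal{X}\subseteq\mathbb{R}^d$ is first countable and endowed with a strictly positive Borel measure $\mu$; $K:\mathcal{X}\times\mathcal{X}\to\mathbb{R}$ is continuous, symmetric, positive semidefinite in the sense that $\int_{\mathcal{X}\times\mathcal{X}} K(x,x')g(x)g(x')\,d\mu(x)d\mu(x')\ge 0$ for all $g\in L^2_\mu(\mathcal{X})$, and $\int_{\mathcal{X}}|K(x,x)|\,d\mu(x)<\infty$. The $\lambda_i\ge0$ are the eigenvalues and the $\phi_i$ the eigenfunctions (orthonormal in $L^2_\mu(\mathcal{X})$, real-valued, defined pointwise) of the integral operator $T_Kg=\int_{\mathcal{X}} K(x,x')g(x')\,d\mu(x')$, and $K(x,x')=\sum_{i=1}^{\ell_{GP}}\lambda_i\phi_i(x)\phi_i(x')$ with absolute convergence for every pair $(x,x')$ (Mercer expansion); $\ell_{GP}$ is finite or infinite. Empty sums are zero. Orthogonalizing rule: nodes $x_k\in\mathcal{X}$ and weights $w_k\in\mathbb{R}$ orthogonalize $\phi_1,\dots,\phi_\ell$ if $\sum_{k=1}^N w_k\phi_i(x_k)\phi_j(x_k)=\delta_{ij}$ for all $i,j=1,\dots,\ell$. Notation: $\bm{\phi}_j=[\phi_j(x_1),\dots,\phi_j(x_N)]^T\in\mathbb{R}^N$; $\mathbf{I}$ is the $N\times N$ identity. The posterior variance of the Gaussian process is $c(x)=K(x,x)-K(\bm{x},x)^T\mathbf{R}K(\bm{x},x)$ with $K(\bm{x},x)=[K(x_1,x),\dots,K(x_N,x)]^T$, and its integral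 is $\int c\,d\mu=\sum_{i=1}^{\ell_{GP}}\lambda_i(1-\lambda_i\bm{\phi}_i^T\mathbf{R}\bm{\phi}_i)$; the left-hand side of the claim is the part of this sum with $i\le\ell$. *)

theory Defs
  imports "HOL-Analysis.Analysis" "HOL-Library.Extended_Nat"
begin

definition L2_fun :: "'a measure \<Rightarrow> ('a \<Rightarrow> real) \<Rightarrow> bool" where
  "L2_fun \<mu> g \<longleftrightarrow> g \<in> borel_measurable \<mu> \<and> integrable \<mu> (\<lambda>x. (g x)\<^sup>2)"

definition integral_operator ::
    "'a measure \<Rightarrow> ('a \<Rightarrow> 'a \<Rightarrow> real) \<Rightarrow> ('a \<Rightarrow> real) \<Rightarrow> 'a \<Rightarrow> real" where
  "integral_operator \<mu> K g x = (LINT x'|\<mu>. K x x' * g x')"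

text \<open>Indices are 1-based, as in the informal notation; \<open>lGP = \<infinity>\<close> gives all positive integers.\<close>

definition eigen_indices :: "enat \<Rightarrow> nat set" where
  "eigen_indices lGP = {i. 1 \<le> i \<and> enat i \<le> lGP}"

text \<open>
  The double integral in \<open>psd\<close> is an iterated one because \<open>\<mu>\<close> is not assumed to be
  sigma-finite, so that a product measure need not be available. The eigenvalues are not
  assumed to be sorted, and \<open>0\<close> may occur among them. Every nonzero eigenvalue of
  the integral operator occurs among the \<open>lam i\<close>, as a consequence of \<open>mercer_expansion\<close>.
\<close>

locale mercer_kernel =
  fixes X :: "(real ^ 'd) set"
    and \<mu> :: "(real ^ 'd) measure"
    and K :: "real ^ 'd \<Rightarrow> real ^ 'd \<Rightarrow> real"
    and lGP :: enat
    and lam :: "nat \<Rightarrow> real"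
    and phi :: "nat \<Rightarrow> real ^ 'd \<Rightarrow> real"
  assumes first_countable_X: "first_countable (top_of_set X)"
    and space_mu: "space \<mu> = X"
    and sets_mu: "sets \<mu> = sets (restrict_space borel X)"
    and strictly_positive:
      "\<And>U. openin (top_of_set X) U \<Longrightarrow> U \<noteq> {} \<Longrightarrow> 0 < emeasure \<mu> U"
    and continuous: "continuous_on (X \<times> X) (\<lambda>(x, x'). K x x')"
    and symmetric: "\<And>x x'. x \<in> X \<Longrightarrow> x' \<in> X \<Longrightarrow> K x x' = K x' x"
    and psd: "\<And>g. L2_fun \<mu> g \<Longrightarrow> 0 \<le> (LINT x'|\<mu>. LINT x|\<mu>. K x x' * g x * g x')"
    and trace_class: "integrable \<mu> (\<lambda>x. \<bar>K x x\<bar>)"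
    and eigenvalue_nonneg: "\<And>i. i \<in> eigen_indices lGP \<Longrightarrow> 0 \<le> lam i"
    and eigenfunction_L2: "\<And>i. i \<in> eigen_indices lGP \<Longrightarrow> L2_fun \<mu> (phi i)"
    and eigenfunction: "\<And>i x. i \<in> eigen_indices lGP \<Longrightarrow> x \<in> X \<Longrightarrow>
      integral_operator \<mu> K (phi i) x = lam i * phi i x"
    and orthonormal: "\<And>i j. i \<in> eigen_indices lGP \<Longrightarrow> j \<in> eigen_indices lGP \<Longrightarrow>
      (LINT x|\<mu>. phi i x * phi j x) = (if i = j then 1 else 0)"
    and mercer_abs_summable: "\<And>x x'. x \<in> X \<Longrightarrow> x' \<in> X \<Longrightarrow>
      (\<lambda>i. \<bar>lam i * phi i x * phi i x'\<bar>) summable_on eigen_indices lGP"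
    and mercer_expansion: "\<And>x x'. x \<in> X \<Longrightarrow> x' \<in> X \<Longrightarrow>
      K x x' = (\<Sum>\<^sub>\<infinity>i\<in>eigen_indices lGP. lam i * phi i x * phi i x')"

definition orthogonalizes ::
    "nat \<Rightarrow> (nat \<Rightarrow> 'a \<Rightarrow> real) \<Rightarrow> ('n::finite \<Rightarrow> 'a) \<Rightarrow> ('n \<Rightarrow> real) \<Rightarrow> bool" where
  "orthogonalizes l phi x w \<longleftrightarrow>
    (\<forall>i\<in>{1..l}. \<forall>j\<in>{1..l}.
      (\<Sum>k\<in>UNIV. w k * phi i (x k) * phi j (x k)) = (if i = j then 1 else 0))"

definition diag_matrix :: "('n::finite \<Rightarrow> real) \<Rightarrow> real ^ 'n ^ 'n" where
  "diag_matrix w = (\<chi> i j. if i = j then w i else 0)"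

definition outer_product :: "real ^ 'n \<Rightarrow> real ^ 'n \<Rightarrow> real ^ 'n ^ 'n" where
  "outer_product u v = (\<chi> i j. u $ i * v $ j)"

definition eval_vec :: "('a \<Rightarrow> real) \<Rightarrow> ('n::finite \<Rightarrow> 'a) \<Rightarrow> real ^ 'n" where
  "eval_vec f x = (\<chi> k. f (x k))"

definition regularized_gram ::
    "('a \<Rightarrow> 'a \<Rightarrow> real) \<Rightarrow> real \<Rightarrow> ('n::finite \<Rightarrow> 'a) \<Rightarrow> real ^ 'n ^ 'n" where
  "regularized_gram K s2 x = (\<chi> i j. K (x i) (x j) + (if i = j then s2 else 0))"

end

theory Submission
  imports Defs
begin

text \<open>
  Split the Mercer sum at \<open>l\<close>: the regularized Gram matrix is the head, with the first \<open>l\<close> terms,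
  plus the matrix \<open>M\<close> of tail and nugget, so \<open>M R = I - head R\<close>. Sandwiching this between
  \<open>p\<^sub>i\<^sup>T W\<close> and \<open>p\<^sub>i\<close>, orthogonalization says \<open>p\<^sub>i\<^sup>T W p\<^sub>j = \<delta>\<^sub>i\<^sub>j\<close>, which leaves
  \<open>1 - \<lambda>\<^sub>i p\<^sub>i\<^sup>T R p\<^sub>i\<close>. The claim thus holds term by term.
\<close>

text \<open>Convergence in a finite product is componentwise. Applied twice, first to rows and then
  to entries, it lifts the pointwise Mercer expansion to a series of matrices.\<close>

lemma has_sum_vec:
  fixes f :: "'a \<Rightarrow> 'b::real_normed_vector ^ 'n"
  assumes "\<And>i. ((\<lambda>x. f x $ i) has_sum s $ i) A"
  shows "(f has_sum s) A"
  using assms unfolding has_sum_def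
  by (auto intro!: vec_tendstoI)

lemma outer_product_mult_vec: "outer_product u v *v z = (v \<bullet> z) *\<^sub>R u"
  by (simp add: outer_product_def matrix_vector_mult_def inner_vec_def vec_eq_iff
      sum_distrib_left sum_distrib_right mult_ac)

text \<open>Lets the quadrature sums in \<open>orthogonalizes\<close> be read as values of the
  bilinear form of the weight matrix.\<close>

lemma inner_diag_matrix_eval_vec:
  "eval_vec f x \<bullet> (diag_matrix w *v eval_vec g x) = (\<Sum>k\<in>UNIV. w k * f (x k) * g (x k))"
  by (simp add: diag_matrix_def eval_vec_def matrix_vector_mult_def inner_vec_def mult_ac
      if_distrib[of "\<lambda>u. _ * u"] cong: if_cong)

lemma sum_matrix_vector_mult:
  fixes A :: "'a \<Rightarrow> real ^ 'n ^ 'm"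
  shows "(\<Sum>i\<in>I. A i) *v z = (\<Sum>i\<in>I. A i *v z)"
  by (induction I rule: infinite_finite_induct) (simp_all add: matrix_vector_mult_add_rdistrib)

lemma (in mercer_kernel) regularized_gram_split:
  fixes x :: "'n::finite \<Rightarrow> real ^ 'd"
  assumes x: "\<And>k. x k \<in> X" and l: "enat l \<le> lGP"
  shows "regularized_gram K s2 x =
    (\<Sum>j=1..l. lam j *\<^sub>R outer_product (eval_vec (phi j) x) (eval_vec (phi j) x)) +
    ((\<Sum>\<^sub>\<infinity>j\<in>{j\<in>eigen_indices lGP. l < j}.
        lam j *\<^sub>R outer_product (eval_vec (phi j) x) (eval_vec (phi j) x)) + s2 *\<^sub>R mat 1)"
proof -
  let ?q = "\<lambda>j. lam j *\<^sub>R outer_product (eval_vec (phi j) x) (eval_vec (phi j) x)"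
  let ?I = "eigen_indices lGP" and ?T = "{j\<in>eigen_indices lGP. l < j}"
  let ?G = "(\<chi> a b. K (x a) (x b)) :: real ^ 'n ^ 'n"
  \<comment> \<open>An equation with an infinite sum does not by itself give convergence, as
    \<open>infsum\<close> defaults to 0 for families that are not summable; absolute summability
    supplies it.\<close>
  have "((\<lambda>j. lam j * phi j (x a) * phi j (x b)) has_sum K (x a) (x b)) ?I" for a b
    unfolding mercer_expansion[OF x x]
    using mercer_abs_summable[OF x x, of a b]
    by (simp add: has_sum_infsum abs_summable_summable)
  then have G: "(?q has_sum ?G) ?I"
    by (intro has_sum_vec) (simp add: outer_product_def eval_vec_def mult.assoc)
  have "{1..l} \<subseteq> ?I"
    using l by (auto simp: eigen_indices_def intro: order_trans[of "enat _" "enat l"])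
  \<comment> \<open>Removing finitely many terms keeps convergence, so the tail below is a genuine
    limit and not the default 0. For \<open>lGP = enat l\<close> the tail is empty.\<close>
  with G have "(?q has_sum (?G - (\<Sum>j=1..l. ?q j))) (?I - {1..l})"
    by (intro has_sum_Diff has_sum_finite finite_atLeastAtMost)
  moreover have "?I - {1..l} = ?T"
    by (auto simp: eigen_indices_def)
  ultimately have "(?q has_sum (?G - (\<Sum>j=1..l. ?q j))) ?T"
    by (simp only:)
  then have "(\<Sum>\<^sub>\<infinity>j\<in>?T. ?q j) = ?G - (\<Sum>j=1..l. ?q j)"
    by (rule infsumI)
  moreover have "regularized_gram K s2 x = ?G + s2 *\<^sub>R mat 1"
    by (simp add: regularized_gram_def mat_def vec_eq_iff)
  ultimately show ?thesis
    by simp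
qed

theorem mainTheorem3:
  fixes X :: "(real ^ 'd) set"
    and \<mu> :: "(real ^ 'd) measure"
    and K :: "real ^ 'd \<Rightarrow> real ^ 'd \<Rightarrow> real"
    and lGP :: enat
    and lam :: "nat \<Rightarrow> real"
    and phi :: "nat \<Rightarrow> real ^ 'd \<Rightarrow> real"
    and l :: nat
    and x :: "'n::finite \<Rightarrow> real ^ 'd"
    and w :: "'n \<Rightarrow> real"
    and sigma2 :: real
    and W R :: "real ^ 'n ^ 'n"
    and p :: "nat \<Rightarrow> real ^ 'n"
  assumes "mercer_kernel X \<mu> K lGP lam phi"
    and "1 \<le> l" and "enat l \<le> lGP"
    and "\<And>k. x k \<in> X"
    and "orthogonalizes l phi x w"
    and "0 \<le> sigma2"
    and "invertible (regularized_gram K sigma2 x)"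
  defines "W \<equiv> diag_matrix w"
    and "R \<equiv> matrix_inv (regularized_gram K sigma2 x)"
    and "p \<equiv> (\<lambda>j. eval_vec (phi j) x)"
  shows "(\<Sum>i=1..l. lam i * (1 - lam i * (p i \<bullet> (R *v p i)))) =
    (\<Sum>i=1..l. lam i *
      (p i \<bullet> ((W **
        ((\<Sum>\<^sub>\<infinity>j\<in>{j\<in>eigen_indices lGP. l < j}. lam j *\<^sub>R outer_product (p j) (p j))
          + sigma2 *\<^sub>R mat 1) ** R) *v p i)))"
proof -
  interpret mercer_kernel X \<mu> K lGP lam phi by fact
  define H where "H = (\<Sum>j=1..l. lam j *\<^sub>R outer_product (p j) (p j))"
  define M where "M = (\<Sum>\<^sub>\<infinity>j\<in>{j\<in>eigen_indices lGP. l < j}. lam j *\<^sub>R outer_product (p j) (p j))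
    + sigma2 *\<^sub>R mat 1"
  have "regularized_gram K sigma2 x = H + M"
    unfolding H_def M_def p_def using assms(4,3) by (rule regularized_gram_split)
  \<comment> \<open>\<open>matrix_inv\<close> is a choice, and invertibility ensures that the chosen
    matrix is an inverse.\<close>
  then have HMR: "(H + M) ** R = mat 1"
    using someI_ex[OF assms(7)[unfolded invertible_def]] by (simp add: R_def matrix_inv_def)
  have WMR: "p i \<bullet> ((W ** M ** R) *v p i) = 1 - lam i * (p i \<bullet> (R *v p i))" if i: "i \<in> {1..l}" for i
  proof -
    have orth: "p i \<bullet> (W *v p j) = (if i = j then 1 else 0)" if "j \<in> {1..l}" for j
      using assms(5) i that by (simp add: p_def W_def inner_diag_matrix_eval_vec orthogonalizes_def)
    have "M *v (R *v p i) = p i - H *v (R *v p i)"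
      using arg_cong[OF HMR, of "\<lambda>A. A *v p i"]
      by (simp add: matrix_vector_mult_add_rdistrib algebra_simps
          flip: matrix_vector_mul_assoc)
    \<comment> \<open>Each summand of \<open>H\<close> has rank one, so the head maps every vector
      into the span of the \<open>p j\<close> with \<open>j\<close> at most \<open>l\<close>, where
      \<open>orth\<close> applies.\<close>
    also have "H *v (R *v p i) = (\<Sum>j=1..l. (lam j * (p j \<bullet> (R *v p i))) *\<^sub>R p j)"
      by (simp add: H_def sum_matrix_vector_mult outer_product_mult_vec
          flip: scaleR_matrix_vector_assoc)
    finally have "p i \<bullet> (W *v (M *v (R *v p i))) =
        p i \<bullet> (W *v p i) - (\<Sum>j=1..l. lam j * (p j \<bullet> (R *v p i)) * (p i \<bullet> (W *v p j)))"
      by (simp add: matrix_vector_mult_diff_distrib inner_diff_right inner_sum_right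
          linear_sum[OF matrix_vector_mul_linear] matrix_vector_mult_scaleR)
    \<comment> \<open>By \<open>orth\<close>, pairing with \<open>p i\<close> through
      \<open>W\<close> extracts the coefficient of \<open>p i\<close>.\<close>
    also have "(\<Sum>j=1..l. lam j * (p j \<bullet> (R *v p i)) * (p i \<bullet> (W *v p j))) =
        (\<Sum>j=1..l. if i = j then lam i * (p i \<bullet> (R *v p i)) else 0)"
      by (intro sum.cong) (simp_all add: orth)
    also have "\<dots> = lam i * (p i \<bullet> (R *v p i))"
      using i by simp
    finally show ?thesis
      using orth[OF i] by (simp add: matrix_vector_mul_assoc matrix_mul_assoc)
  qed
  show ?thesis
    unfolding M_def[symmetric] by (intro sum.cong) (simp_all only: WMR)
qed

end
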